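(* Let $F\in\{F_9,F_{10}\}$ and $G\in\{F_9^c,F_{10}^c\}$. Then, as $m\to\infty$, $$\mathrm{forb}(m,\{F,G\})=\Theta(m^2).$$
   Context: A matrix is simple if it is a $(0,1)$-matrix with no repeated columns. $F\prec A$ means that some submatrix of $A$ is a row and column permutation of $F$. For a family $\mathcal F$ of $(0,1)$-matrices, $\mathrm{forb}(m,\mathcal F)$ is the maximum number of columns of an $m$-rowed simple matrix $A$ with $F\nprec A$ for all $F\in\mathcal F$. $A^c$ denotes the $(0,1)$-complement of $A$, and $$F_9=\begin{bmatrix}1&0&0\\0&1&0\\0&0&1\\0&0&1\end{bmatrix},\quad F_{10}=\begin{bmatrix}1&0&0\\0&1&0\\0&0&1\\0&0&0\end{bmatrix}.$$ *)

theory Defs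
  imports
    "Jordan_Normal_Form.DL_Submatrix"
    "HOL-Combinatorics.Permutations"
    "HOL-Library.Landau_Symbols"
begin

definition zero_one_mat :: "int mat \<Rightarrow> bool" where
  "zero_one_mat A \<longleftrightarrow> elements_mat A \<subseteq> {0, 1}"

definition simple_mat :: "int mat \<Rightarrow> bool" where
  "simple_mat A \<longleftrightarrow> zero_one_mat A \<and> distinct (cols A)"

definition row_col_permutation :: "int mat \<Rightarrow> int mat \<Rightarrow> bool" where
  "row_col_permutation F B \<longleftrightarrow>
     (\<exists>p q. p permutes {..<dim_row F} \<and> q permutes {..<dim_col F} \<and>
        B = mat (dim_row F) (dim_col F) (\<lambda>(i, j). F $$ (p i, q j)))"

text \<open>The relation \<open>F \<prec> A\<close>. The submatrix of \<open>A\<close> is selected by a set of row indices and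
  a set of column indices, in their original order; indices start at 0.\<close>

definition config_of :: "int mat \<Rightarrow> int mat \<Rightarrow> bool" where
  "config_of F A \<longleftrightarrow>
     (\<exists>I J. I \<subseteq> {..<dim_row A} \<and> J \<subseteq> {..<dim_col A} \<and>
        row_col_permutation F (submatrix A I J))"

definition avoiding_mats :: "nat \<Rightarrow> int mat set \<Rightarrow> int mat set" where
  "avoiding_mats m \<F> =
     {A. simple_mat A \<and> dim_row A = m \<and> (\<forall>F\<in>\<F>. \<not> config_of F A)}"

text \<open>The maximum is over a finite set, since an \<open>m\<close>-rowed simple matrix has at most \<open>2 ^ m\<close>
  columns. If every matrix in the family has a column, the set is also nonempty, because the
  matrix with \<open>m\<close> rows and no columns counts as a simple matrix avoiding the family.\<close>

definition forb :: "nat \<Rightarrow> int mat set \<Rightarrow> nat" where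
  "forb m \<F> = Max (dim_col ` avoiding_mats m \<F>)"

definition complement_mat :: "int mat \<Rightarrow> int mat" where
  "complement_mat A = map_mat (\<lambda>x. 1 - x) A"

definition F9 :: "int mat" where
  "F9 = mat_of_rows_list 3
     [[1, 0, 0],
      [0, 1, 0],
      [0, 0, 1],
      [0, 0, 1]]"

definition F10 :: "int mat" where
  "F10 = mat_of_rows_list 3
     [[1, 0, 0],
      [0, 1, 0],
      [0, 0, 1],
      [0, 0, 0]]"

end

theory Submission
  imports Defs
begin

text \<open>
  Upper bound: deleting a row of a simple matrix either keeps columns distinct or merges pairs of
  columns that differ in that row only. Hence a family with more than \<open>1 + m k\<close> members has, after
  deleting some rows, more than \<open>k\<close> members occurring with both entries in some further row. Doing
  this twice gives four rows \<open>r, s, x, y\<close> on which the traces include \<open>{0,1}\<^sup>2 \<times> S\<close> with \<open>|S| \<ge> 3\<close>.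
  If \<open>00 \<in> S\<close> then both \<open>F\<^sub>9\<close> and \<open>F\<^sub>1\<^sub>0\<close> occur; otherwise \<open>11 \<in> S\<close> and both complements occur.

  Lower bound: in the product of two tower matrices, among any three rows two come from the same
  tower, so neither the \<open>3 \<times> 3\<close> identity matrix nor its complement occurs.
\<close>

section \<open>Configurations as embeddings\<close>

lemma inj_on_pick: "inj_on (pick K) {..<card K}"
  by (rule inj_on_inverseI[where g = "\<lambda>a. card {b \<in> K. b < a}"]) (simp add: card_pick_le)

text \<open>An injection lists its image in some order and \<open>pick\<close> lists it in
  increasing order, so the two differ by a permutation of the positions.\<close>

lemma ex_permutes_pick:
  assumes "inj_on f {..<k}"
  shows "\<exists>p. p permutes {..<k} \<and> (\<forall>i<k. f (p i) = pick (f ` {..<k}) i)"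
proof -
  let ?I = "f ` {..<k}"
  have card: "card ?I = k" using assms by (simp add: card_image)
  have inj: "inj_on (pick ?I) {..<k}"
    using inj_on_pick[of ?I] card by simp
  have pick: "pick ?I i \<in> ?I" if "i < k" for i
    using that card by (metis pick_in_set_le)
  \<comment> \<open>The \<open>else\<close> branch fixes everything outside \<open>{..<k}\<close>,
    as \<open>permutes\<close> demands.\<close>
  let ?h = "\<lambda>i. if i \<in> {..<k} then inv_into {..<k} f (pick ?I i) else i"
  have maps: "?h i < k" if "i < k" for i
    using inv_into_into[OF pick[OF that]] that by simp
  have f_h: "f (?h i) = pick ?I i" if "i < k" for i
    using f_inv_into_f[OF pick[OF that]] that by simp
  have "inj_on ?h {..<k}"
    by (rule inj_onI) (metis f_h inj inj_onD lessThan_iff)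
  moreover have "?h ` {..<k} \<subseteq> {..<k}" using maps by auto
  ultimately have "bij_betw ?h {..<k} {..<k}"
    using endo_inj_surj[of "{..<k}" ?h] unfolding bij_betw_def by blast
  then have "?h permutes {..<k}"
    by (rule bij_imp_permutes) simp
  with f_h show ?thesis by blast
qed

text \<open>Index sets together with permutations carry the same information as injections. The
  injection form lets an occurrence be given, or refuted, by naming its rows and columns in any
  order.\<close>

lemma config_of_iff:
  "config_of F A \<longleftrightarrow>
     (\<exists>f g. inj_on f {..<dim_row F} \<and> f ` {..<dim_row F} \<subseteq> {..<dim_row A} \<and>
            inj_on g {..<dim_col F} \<and> g ` {..<dim_col F} \<subseteq> {..<dim_col A} \<and>
            (\<forall>i<dim_row F. \<forall>j<dim_col F. A $$ (f i, g j) = F $$ (i, j)))"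
    (is "_ \<longleftrightarrow> (\<exists>f g. ?emb f g)")
proof
  assume "config_of F A"
  then obtain I J p q where I: "I \<subseteq> {..<dim_row A}" and J: "J \<subseteq> {..<dim_col A}"
    and p: "p permutes {..<dim_row F}" and q: "q permutes {..<dim_col F}"
    and eq: "submatrix A I J = mat (dim_row F) (dim_col F) (\<lambda>(i, j). F $$ (p i, q j))"
    unfolding config_of_def row_col_permutation_def by blast
  have [simp]: "{i. i < dim_row A \<and> i \<in> I} = I" "{j. j < dim_col A \<and> j \<in> J} = J"
    using I J by auto
  have cI: "card I = dim_row F" and cJ: "card J = dim_col F"
    using arg_cong[OF eq, of dim_row] arg_cong[OF eq, of dim_col] by (simp_all add: dim_submatrix)
  have inv_lt: "inv_into UNIV p i < dim_row F \<longleftrightarrow> i < dim_row F" "inv_into UNIV q j < dim_col F \<longleftrightarrow> j < dim_col F" for i j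
    using permutes_in_image[OF permutes_inv[OF p]] permutes_in_image[OF permutes_inv[OF q]] by auto
  \<comment> \<open>Entry \<open>(p i, q j)\<close> of \<open>F\<close> sits at position
    \<open>(i, j)\<close> of the submatrix, so the inverse permutations recover where entry
    \<open>(i, j)\<close> of \<open>F\<close> lies.\<close>
  have "?emb (pick I \<circ> inv_into UNIV p) (pick J \<circ> inv_into UNIV q)"
  proof (intro conjI allI impI)
    show "inj_on (pick I \<circ> inv_into UNIV p) {..<dim_row F}"
      using inj_on_pick[of I] permutes_inv[OF p] cI
      by (intro comp_inj_on) (simp_all add: permutes_image permutes_inj_on[of _ "{..<dim_row F}"])
    show "inj_on (pick J \<circ> inv_into UNIV q) {..<dim_col F}"
      using inj_on_pick[of J] permutes_inv[OF q] cJ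
      by (intro comp_inj_on) (simp_all add: permutes_image permutes_inj_on[of _ "{..<dim_col F}"])
    show "(pick I \<circ> inv_into UNIV p) ` {..<dim_row F} \<subseteq> {..<dim_row A}"
    proof (rule image_subsetI)
      fix k assume "k \<in> {..<dim_row F}"
      then have "pick I (inv_into UNIV p k) \<in> I"
        using cI by (intro pick_in_set_le) (simp add: inv_lt)
      then show "(pick I \<circ> inv_into UNIV p) k \<in> {..<dim_row A}" using I by auto
    qed
    show "(pick J \<circ> inv_into UNIV q) ` {..<dim_col F} \<subseteq> {..<dim_col A}"
    proof (rule image_subsetI)
      fix k assume "k \<in> {..<dim_col F}"
      then have "pick J (inv_into UNIV q k) \<in> J"
        using cJ by (intro pick_in_set_le) (simp add: inv_lt)
      then show "(pick J \<circ> inv_into UNIV q) k \<in> {..<dim_col A}" using J by auto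
    qed
    fix i j assume "i < dim_row F" "j < dim_col F"
    then show "A $$ ((pick I \<circ> inv_into UNIV p) i, (pick J \<circ> inv_into UNIV q) j) = F $$ (i, j)"
      using submatrix_index[of "inv_into UNIV p i" A I "inv_into UNIV q j" J] cI cJ p q
      by (simp add: eq inv_lt permutes_inverses)
  qed
  then show "\<exists>f g. ?emb f g" by blast
next
  assume "\<exists>f g. ?emb f g"
  then obtain f g where emb: "?emb f g" by blast
  let ?I = "f ` {..<dim_row F}" and ?J = "g ` {..<dim_col F}"
  obtain p q where p: "p permutes {..<dim_row F}" "\<forall>i<dim_row F. f (p i) = pick ?I i"
    and q: "q permutes {..<dim_col F}" "\<forall>j<dim_col F. g (q j) = pick ?J j"
    using emb ex_permutes_pick by metis
  have lt: "p i < dim_row F \<longleftrightarrow> i < dim_row F" "q j < dim_col F \<longleftrightarrow> j < dim_col F" for i j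
    using permutes_in_image[OF p(1)] permutes_in_image[OF q(1)] by auto
  have "{i. i < dim_row A \<and> i \<in> ?I} = ?I" "{j. j < dim_col A \<and> j \<in> ?J} = ?J"
    using emb by auto
  moreover have "card ?I = dim_row F" "card ?J = dim_col F"
    using emb by (simp_all add: card_image)
  moreover have "A $$ (pick ?I i, pick ?J j) = F $$ (p i, q j)" if "i < dim_row F" "j < dim_col F" for i j
  proof -
    have "A $$ (f (p i), g (q j)) = F $$ (p i, q j)" using emb that lt by blast
    then show ?thesis using p(2) q(2) that by simp
  qed
  ultimately have "submatrix A ?I ?J = mat (dim_row F) (dim_col F) (\<lambda>(i, j). F $$ (p i, q j))"
    unfolding submatrix_def by (intro eq_matI) simp_all
  then have "row_col_permutation F (submatrix A ?I ?J)"
    using p q unfolding row_col_permutation_def by blast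
  then show "config_of F A"
    using emb unfolding config_of_def by blast
qed

section \<open>Complements of configurations\<close>

lemma dim_complement_mat [simp]:
  "dim_row (complement_mat A) = dim_row A" "dim_col (complement_mat A) = dim_col A"
  by (simp_all add: complement_mat_def)

lemma index_complement_mat [simp]:
  "i < dim_row A \<Longrightarrow> j < dim_col A \<Longrightarrow> complement_mat A $$ (i, j) = 1 - A $$ (i, j)"
  by (simp add: complement_mat_def)

text \<open>Complementing is an involution on entries. This moves the complement from the forbidden
  matrix to the host, so only \<open>F9\<close> and \<open>F10\<close> ever have to be
  built.\<close>

lemma config_of_complement:
  "config_of (complement_mat F) A \<longleftrightarrow> config_of F (complement_mat A)"
proof -
  have "complement_mat A $$ (f i, g j) = F $$ (i, j) \<longleftrightarrow> A $$ (f i, g j) = complement_mat F $$ (i, j)"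
    if "f ` {..<dim_row F} \<subseteq> {..<dim_row A}" "g ` {..<dim_col F} \<subseteq> {..<dim_col A}"
       "i < dim_row F" "j < dim_col F" for f g i j
  proof -
    have "f i < dim_row A" "g j < dim_col A" using that by auto
    then show ?thesis using that by auto
  qed
  then show ?thesis
    unfolding config_of_iff dim_complement_mat by (intro iff_exI) blast
qed

section \<open>Occurrences on four listed rows\<close>

lemma dim_F9 [simp]: "dim_row F9 = 4" "dim_col F9 = 3"
  by (simp_all add: F9_def mat_of_rows_list_def)

lemma dim_F10 [simp]: "dim_row F10 = 4" "dim_col F10 = 3"
  by (simp_all add: F10_def mat_of_rows_list_def)

text \<open>The rows form a list, so permuting the rows of a configuration amounts to reordering
  \<open>rs\<close>.\<close>

definition column_with :: "int mat \<Rightarrow> nat \<Rightarrow> nat list \<Rightarrow> int list \<Rightarrow> bool" where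
  "column_with A j rs vs \<longleftrightarrow> j < dim_col A \<and> map (\<lambda>i. A $$ (i, j)) rs = vs"

text \<open>The columns of \<open>F\<close> differ pairwise, hence so do the columns of
  \<open>A\<close> that realise them, and \<open>g\<close> is injective.\<close>

lemma config_of_fourI:
  assumes "distinct rs" "length rs = 4" "set rs \<subseteq> {..<dim_row A}"
    and "dim_row F = 4" "dim_col F = 3"
    and "\<And>k. k < 3 \<Longrightarrow> column_with A (g k) rs (map (\<lambda>i. F $$ (i, k)) [0..<4])"
    and "inj_on (\<lambda>k. map (\<lambda>i. F $$ (i, k)) [0..<4]) {..<3}"
  shows "config_of F A"
proof -
  have "inj_on g {..<3}"
  proof (rule inj_onI)
    fix k l assume "k \<in> {..<3}" "l \<in> {..<3}" "g k = g l"
    then have "map (\<lambda>i. F $$ (i, k)) [0..<4] = map (\<lambda>i. F $$ (i, l)) [0..<4]"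
      using assms(6)[of k] assms(6)[of l] by (simp add: column_with_def)
    then show "k = l"
      using assms(7) \<open>k \<in> _\<close> \<open>l \<in> _\<close> by (simp add: inj_on_def del: map_eq_conv)
  qed
  moreover have "A $$ (rs ! i, g k) = F $$ (i, k)" if "i < 4" "k < 3" for i k
  proof -
    have "map (\<lambda>i. A $$ (i, g k)) rs ! i = map (\<lambda>i. F $$ (i, k)) [0..<4] ! i"
      using assms(6)[OF that(2)] by (simp add: column_with_def)
    then show ?thesis using that assms(2) by simp
  qed
  moreover have "inj_on ((!) rs) {..<4}"
    using assms(1,2) by (auto simp: inj_on_def nth_eq_iff_index_eq)
  moreover have "(!) rs ` {..<4} \<subseteq> {..<dim_row A}"
    using assms(2,3) by (auto simp: set_conv_nth)
  moreover have "g ` {..<3} \<subseteq> {..<dim_col A}"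
    using assms(6) by (auto simp: column_with_def)
  ultimately show ?thesis
    unfolding config_of_iff using assms(4,5) by (intro exI[of _ "(!) rs"] exI[of _ g]) simp
qed

lemma less_3_cases: "k < (3::nat) \<longleftrightarrow> k = 0 \<or> k = 1 \<or> k = 2"
  by auto

lemma lessThan_3: "{..<3::nat} = {0, 1, 2}"
  by auto

lemma upt_0_4: "[0..<4] = [0, 1, 2, 3::nat]"
  by (simp add: upt_rec)

lemma columns_F9:
  "map (\<lambda>i. F9 $$ (i, 0)) [0..<4] = [1, 0, 0, 0]"
  "map (\<lambda>i. F9 $$ (i, 1)) [0..<4] = [0, 1, 0, 0]"
  "map (\<lambda>i. F9 $$ (i, 2)) [0..<4] = [0, 0, 1, 1]"
  by (simp_all add: F9_def mat_of_rows_list_def upt_0_4)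

lemma columns_F10:
  "map (\<lambda>i. F10 $$ (i, 0)) [0..<4] = [1, 0, 0, 0]"
  "map (\<lambda>i. F10 $$ (i, 1)) [0..<4] = [0, 1, 0, 0]"
  "map (\<lambda>i. F10 $$ (i, 2)) [0..<4] = [0, 0, 1, 0]"
  by (simp_all add: F10_def mat_of_rows_list_def upt_0_4)

lemma config_of_F9I:
  assumes "distinct rs" "length rs = 4" "set rs \<subseteq> {..<dim_row A}"
    and "column_with A a rs [1, 0, 0, 0]" "column_with A b rs [0, 1, 0, 0]"
    and "column_with A c rs [0, 0, 1, 1]"
  shows "config_of F9 A"
proof (rule config_of_fourI[OF assms(1-3), where g = "(!) [a, b, c]"])
  show "column_with A ([a, b, c] ! k) rs (map (\<lambda>i. F9 $$ (i, k)) [0..<4])" if "k < 3" for k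
    using that[unfolded less_3_cases] assms(4-6)
    by (elim disjE) (simp_all only: columns_F9, simp_all)
  show "inj_on (\<lambda>k. map (\<lambda>i. F9 $$ (i, k)) [0..<4]) {..<3}"
    unfolding lessThan_3 by (simp add: columns_F9 columns_F9[unfolded One_nat_def])
qed simp_all

lemma config_of_F10I:
  assumes "distinct rs" "length rs = 4" "set rs \<subseteq> {..<dim_row A}"
    and "column_with A a rs [1, 0, 0, 0]" "column_with A b rs [0, 1, 0, 0]"
    and "column_with A c rs [0, 0, 1, 0]"
  shows "config_of F10 A"
proof (rule config_of_fourI[OF assms(1-3), where g = "(!) [a, b, c]"])
  show "column_with A ([a, b, c] ! k) rs (map (\<lambda>i. F10 $$ (i, k)) [0..<4])" if "k < 3" for k
    using that[unfolded less_3_cases] assms(4-6)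
    by (elim disjE) (simp_all only: columns_F10, simp_all)
  show "inj_on (\<lambda>k. map (\<lambda>i. F10 $$ (i, k)) [0..<4]) {..<3}"
    unfolding lessThan_3 by (simp add: columns_F10 columns_F10[unfolded One_nat_def])
qed simp_all

section \<open>Traces of large set families\<close>

text \<open>Induction on the rows. Deleting a row that is not the desired \<open>r\<close> costs at
  most \<open>k\<close> members, and on no rows at most one member is left. \<open>Z\<close> is what
  remains of the rows once \<open>r\<close> is found.\<close>

lemma ex_row_with_both_traces:
  fixes \<A> :: "'a set set"
  assumes "finite X" "\<A> \<subseteq> Pow X" "card \<A> > 1 + card X * k"
  shows "\<exists>r Z \<B>. r \<in> X \<and> Z \<subseteq> X - {r} \<and> \<B> \<subseteq> Pow Z \<and> card \<B> > k \<and>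
           (\<forall>B\<in>\<B>. {B, insert r B} \<subseteq> (\<lambda>A. A \<inter> insert r Z) ` \<A>)"
  using assms
proof (induction X arbitrary: \<A> rule: finite_induct)
  case empty
  have "card \<A> \<le> card (Pow ({} :: 'a set))"
    using empty.prems(1) by (intro card_mono) auto
  with empty.prems(2) show ?case by simp
next
  case (insert x X)
  define \<A>0 where "\<A>0 = {A \<in> \<A>. x \<notin> A}"
  define \<A>1 where "\<A>1 = {A \<in> \<A>. x \<in> A}"
  define \<A>1' where "\<A>1' = (\<lambda>A. A - {x}) ` \<A>1"
  have fin: "finite \<A>"
    using insert.prems(1) insert.hyps(1) by (meson finite_Pow_iff finite_insert finite_subset)
  have "card \<A> = card \<A>0 + card \<A>1"
    using fin by (subst card_Un_disjoint[symmetric]) (auto simp: \<A>0_def \<A>1_def intro!: arg_cong[of _ _ card])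
  also have "card \<A>1 = card \<A>1'"
    unfolding \<A>1'_def by (rule card_image[symmetric]) (auto simp: inj_on_def \<A>1_def)
  \<comment> \<open>The union is the trace of the family on \<open>X\<close>; the intersection
    collects the traces that extend with both entries in row \<open>x\<close>.\<close>
  also have "card \<A>0 + card \<A>1' = card (\<A>0 \<union> \<A>1') + card (\<A>0 \<inter> \<A>1')"
    using fin by (intro card_Un_Int) (auto simp: \<A>0_def \<A>1_def \<A>1'_def)
  finally have card: "card \<A> = card (\<A>0 \<union> \<A>1') + card (\<A>0 \<inter> \<A>1')" .
  have sub: "\<A>0 \<union> \<A>1' \<subseteq> Pow X"
    using insert.prems(1) by (auto simp: \<A>0_def \<A>1_def \<A>1'_def)
  have restr: "\<exists>A\<in>\<A>. A - {x} = B" if "B \<in> \<A>0 \<union> \<A>1'" for B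
    using that by (auto simp: \<A>0_def \<A>1_def \<A>1'_def)
  show ?case
  proof (cases "card (\<A>0 \<inter> \<A>1') > k")
    case True
    have "{B, insert x B} \<subseteq> (\<lambda>A. A \<inter> insert x X) ` \<A>" if "B \<in> \<A>0 \<inter> \<A>1'" for B
    proof -
      have "B \<in> \<A>" using that by (auto simp: \<A>0_def)
      moreover have "insert x B \<in> \<A>"
        using that by (auto simp: \<A>1'_def \<A>1_def insert_absorb)
      moreover have "A \<inter> insert x X = A" if "A \<in> \<A>" for A
        using insert.prems(1) that by auto
      ultimately show ?thesis by (auto intro: rev_image_eqI)
    qed
    with True insert.hyps(2) sub show ?thesis
      by (intro exI[of _ x] exI[of _ X] exI[of _ "\<A>0 \<inter> \<A>1'"]) auto
  next
    case False
    then have "card (\<A>0 \<union> \<A>1') > 1 + card X * k"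
      using insert.prems(2) insert.hyps card by simp
    from insert.IH[OF sub this] obtain r Z \<B> where
      *: "r \<in> X" "Z \<subseteq> X - {r}" "\<B> \<subseteq> Pow Z" "card \<B> > k"
        "\<forall>B\<in>\<B>. {B, insert r B} \<subseteq> (\<lambda>A. A \<inter> insert r Z) ` (\<A>0 \<union> \<A>1')"
      by (elim exE conjE) (rule that)
    \<comment> \<open>Row \<open>x\<close> lies outside \<open>insert r Z\<close>, so removing it
      beforehand creates no new traces there.\<close>
    have "(\<lambda>A. A \<inter> insert r Z) ` (\<A>0 \<union> \<A>1') \<subseteq> (\<lambda>A. A \<inter> insert r Z) ` \<A>"
    proof
      fix C assume "C \<in> (\<lambda>A. A \<inter> insert r Z) ` (\<A>0 \<union> \<A>1')"
      then obtain B where B: "B \<in> \<A>0 \<union> \<A>1'" "C = B \<inter> insert r Z" by blast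
      obtain A where A: "A \<in> \<A>" "A - {x} = B" using restr B(1) by blast
      have "x \<notin> insert r Z" using * insert.hyps(2) by auto
      then have "C = A \<inter> insert r Z" using A(2) B(2) by auto
      then show "C \<in> (\<lambda>A. A \<inter> insert r Z) ` \<A>" using A(1) by blast
    qed
    with *(5) have "\<forall>B\<in>\<B>. {B, insert r B} \<subseteq> (\<lambda>A. A \<inter> insert r Z) ` \<A>"
      by (meson subset_trans)
    moreover have "r \<in> insert x X" "Z \<subseteq> insert x X - {r}" using *(1,2) by auto
    ultimately show ?thesis
      using *(3,4) by (intro exI[of _ r] exI[of _ Z] exI[of _ \<B>] conjI)
  qed
qed

text \<open>A point separating two of the sets leaves the third in agreement with one of them, and a
  second point separates that pair. Each separating point lies in one of the sets, hence in the
  union.\<close>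

lemma three_sets_two_points:
  assumes "A \<noteq> B" "A \<noteq> C" "B \<noteq> C"
  shows "\<exists>x\<in>A \<union> B \<union> C. \<exists>y\<in>A \<union> B \<union> C. x \<noteq> y \<and>
           distinct (map (\<lambda>D. (x \<in> D, y \<in> D)) [A, B, C])"
proof -
  \<comment> \<open>Here \<open>x\<close> isolates \<open>B\<close>, and it remains to choose
    \<open>y\<close> separating \<open>A\<close> from \<open>C\<close>; then
    \<open>x \<noteq> y\<close>, since \<open>x\<close> does not separate them.\<close>
  have *: "\<exists>x\<in>A \<union> B \<union> C. \<exists>y\<in>A \<union> B \<union> C. x \<noteq> y \<and>
           distinct (map (\<lambda>D. (x \<in> D, y \<in> D)) [A, B, C])"
    if "x \<in> A \<longleftrightarrow> x \<in> C" "x \<in> A \<longleftrightarrow> x \<notin> B" "A \<noteq> C" for x and A B C :: "'a set"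
  proof -
    from that(3) obtain y where "y \<in> A \<longleftrightarrow> y \<notin> C" by blast
    with that show ?thesis
      by (intro bexI[of _ x] bexI[of _ y]) auto
  qed
  from assms(1) obtain x where x: "x \<in> A \<longleftrightarrow> x \<notin> B" by blast
  show ?thesis
  proof (cases "x \<in> A \<longleftrightarrow> x \<in> C")
    case True
    from *[OF True x assms(2)] show ?thesis .
  next
    case False
    with x have "x \<in> B \<longleftrightarrow> x \<in> C" "x \<in> B \<longleftrightarrow> x \<notin> A" by auto
    from *[OF this assms(3)] obtain x y where "x\<in>B \<union> A \<union> C" "y\<in>B \<union> A \<union> C" "x \<noteq> y"
      "distinct (map (\<lambda>D. (x \<in> D, y \<in> D)) [B, A, C])" by blast
    then show ?thesis by (intro bexI[of _ x] bexI[of _ y]) auto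
  qed
qed

text \<open>The row lemma is applied with \<open>k = 1 + card X * 2\<close> to find
  \<open>r\<close>, then with \<open>k = 2\<close> to find \<open>s\<close>. The three sets left
  over are told apart by two further rows.\<close>

lemma ex_product_trace:
  assumes "finite X" "\<A> \<subseteq> Pow X" "card \<A> > 1 + card X * (1 + card X * 2)"
  obtains r s x y and S :: "(bool \<times> bool) set"
  where "distinct [r, s, x, y]" "{r, s, x, y} \<subseteq> X" "card S = 3"
    and "\<And>a b u v. (u, v) \<in> S \<Longrightarrow>
           \<exists>A\<in>\<A>. (r \<in> A \<longleftrightarrow> a) \<and> (s \<in> A \<longleftrightarrow> b) \<and> (x \<in> A \<longleftrightarrow> u) \<and> (y \<in> A \<longleftrightarrow> v)"
proof -
  from ex_row_with_both_traces[OF assms] obtain r Y \<B> where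
    r: "r \<in> X" and Y: "Y \<subseteq> X - {r}" and \<B>: "\<B> \<subseteq> Pow Y" "card \<B> > 1 + card X * 2"
    and r_both: "\<forall>B\<in>\<B>. {B, insert r B} \<subseteq> (\<lambda>A. A \<inter> insert r Y) ` \<A>"
    by (elim exE conjE) (rule that)
  have "finite Y" using Y assms(1) by (meson Diff_subset finite_subset)
  have "card Y \<le> card X" using Y assms(1) by (intro card_mono) auto
  then have "card \<B> > 1 + card Y * 2" using \<B>(2) by linarith
  from ex_row_with_both_traces[OF \<open>finite Y\<close> \<B>(1) this] obtain s Z \<C> where
    s: "s \<in> Y" and Z: "Z \<subseteq> Y - {s}" and \<C>: "\<C> \<subseteq> Pow Z" "card \<C> > 2"
    and s_both: "\<forall>C\<in>\<C>. {C, insert s C} \<subseteq> (\<lambda>B. B \<inter> insert s Z) ` \<B>"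
    by (elim exE conjE) (rule that)
  obtain \<D> where "\<D> \<subseteq> \<C>" "card \<D> = 3"
    using obtain_subset_with_card_n[of 3 \<C>] \<C>(2) by auto
  then obtain C1 C2 C3 where C: "C1 \<noteq> C2" "C1 \<noteq> C3" "C2 \<noteq> C3" "{C1, C2, C3} \<subseteq> \<C>"
    by (auto simp: card_3_iff)
  from three_sets_two_points[OF C(1-3)] obtain x y where
    xy: "x \<in> C1 \<union> C2 \<union> C3" "y \<in> C1 \<union> C2 \<union> C3" "x \<noteq> y"
    and dist: "distinct (map (\<lambda>D. (x \<in> D, y \<in> D)) [C1, C2, C3])" by blast
  define S where "S = set (map (\<lambda>D. (x \<in> D, y \<in> D)) [C1, C2, C3])"
  have xyZ: "x \<in> Z" "y \<in> Z" using xy C(4) \<C>(1) by auto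
  have "card S = 3"
    unfolding S_def using distinct_card[OF dist] by simp
  moreover have "\<exists>A\<in>\<A>. (r \<in> A \<longleftrightarrow> a) \<and> (s \<in> A \<longleftrightarrow> b) \<and> (x \<in> A \<longleftrightarrow> u) \<and> (y \<in> A \<longleftrightarrow> v)"
    if "(u, v) \<in> S" for a b u v
  proof -
    from that obtain D where D: "D \<in> \<C>" "u \<longleftrightarrow> x \<in> D" "v \<longleftrightarrow> y \<in> D"
      using C(4) by (auto simp: S_def)
    \<comment> \<open>\<open>D\<close> is lifted first to \<open>\<B>\<close> with the prescribed
      entry at \<open>s\<close>, then to \<open>\<A>\<close> with the prescribed entry at
      \<open>r\<close>; each lift keeps the entries in the rows already fixed.\<close>
    have "(if b then insert s D else D) \<in> (\<lambda>B. B \<inter> insert s Z) ` \<B>"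
      using bspec[OF s_both D(1)] by auto
    then obtain B where B: "B \<in> \<B>" "B \<inter> insert s Z = (if b then insert s D else D)" by force
    have "(if a then insert r B else B) \<in> (\<lambda>A. A \<inter> insert r Y) ` \<A>"
      using bspec[OF r_both B(1)] by auto
    then obtain A where A: "A \<in> \<A>" "A \<inter> insert r Y = (if a then insert r B else B)" by force
    have iB: "i \<in> A \<longleftrightarrow> i \<in> B" if "i \<in> Y" for i
      using A(2) that Y by (auto split: if_splits)
    have iD: "i \<in> B \<longleftrightarrow> i \<in> D" if "i \<in> Z" for i
      using B(2) that Z by (auto split: if_splits)
    have "r \<in> A \<longleftrightarrow> a"
      using A(2) Y B(1) \<B>(1) by (auto split: if_splits)
    moreover have "s \<in> B \<longleftrightarrow> b"
      using B(2) Z D(1) \<C>(1) by (auto split: if_splits)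
    moreover have "x \<in> Y" "y \<in> Y" using xyZ Z by auto
    ultimately have "(r \<in> A \<longleftrightarrow> a) \<and> (s \<in> A \<longleftrightarrow> b) \<and> (x \<in> A \<longleftrightarrow> u) \<and> (y \<in> A \<longleftrightarrow> v)"
      using iB iD xyZ s D by simp
    with A(1) show ?thesis by blast
  qed
  moreover have "distinct [r, s, x, y]" "{r, s, x, y} \<subseteq> X"
    using r s Y Z xyZ xy(3) by auto
  ultimately show thesis by (intro that[of r s x y S]) blast+
qed

section \<open>Upper bound\<close>

lemma column_eq_iff:
  assumes "j < dim_col A" "k < dim_col A"
  shows "col A j = col A k \<longleftrightarrow> (\<forall>i<dim_row A. A $$ (i, j) = A $$ (i, k))"
  using assms by (auto simp: vec_eq_iff)

lemma zero_one_mat_iff: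
  "zero_one_mat A \<longleftrightarrow> (\<forall>i<dim_row A. \<forall>j<dim_col A. A $$ (i, j) = 0 \<or> A $$ (i, j) = 1)"
  unfolding zero_one_mat_def elements_mat_def by force

lemma simple_mat_iff:
  "simple_mat A \<longleftrightarrow>
     (\<forall>i<dim_row A. \<forall>j<dim_col A. A $$ (i, j) = 0 \<or> A $$ (i, j) = 1) \<and>
     (\<forall>j<dim_col A. \<forall>k<dim_col A. (\<forall>i<dim_row A. A $$ (i, j) = A $$ (i, k)) \<longrightarrow> j = k)"
  unfolding simple_mat_def zero_one_mat_iff cols_def
  by (auto simp: distinct_map inj_on_def column_eq_iff)

text \<open>The pair \<open>(0, 0)\<close> supplies the first two columns of both matrices on
  \<open>r, s\<close>. Only one of the four pairs is missing from \<open>S\<close>, so a third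
  column can be found as well, for \<open>F9\<close> possibly after exchanging the two pairs of
  rows.\<close>

lemma config_of_F9_F10_of_product_trace:
  assumes rows: "distinct [r, s, x, y]" "{r, s, x, y} \<subseteq> {..<dim_row A}"
    and S: "card S = 3" "(0, 0) \<in> S" "S \<subseteq> {0, 1} \<times> {0, 1}"
    and tr: "\<And>a b u v. a \<in> {0, 1} \<Longrightarrow> b \<in> {0, 1} \<Longrightarrow> (u, v) \<in> S \<Longrightarrow>
               \<exists>j. column_with A j [r, s, x, y] [a, b, u, v]"
  shows "config_of F9 A \<and> config_of F10 A"
proof -
  have miss: "p \<in> S \<or> q \<in> S" if "p \<noteq> q" "p \<in> {0, 1} \<times> {0, 1}" "q \<in> {0, 1} \<times> {0, 1}" for p q
  proof (rule ccontr)
    assume "\<not> ?thesis"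
    then have "card S \<le> card ({0, 1} \<times> {0, 1} - {p, q} :: (int \<times> int) set)"
      using S(3) by (intro card_mono) auto
    also have "\<dots> = 2"
      using that by (subst card_Diff_subset) auto
    finally show False using S(1) by simp
  qed
  have cols: "\<exists>j. column_with A j [r, s, x, y] [a, b, u, v]"
    if "a \<in> {0, 1}" "b \<in> {0, 1}" "(u, v) \<in> S" for a b u v using tr that by blast
  obtain a where a: "column_with A a [r, s, x, y] [1, 0, 0, 0]" using cols[of 1 0 0 0] S(2) by auto
  obtain b where b: "column_with A b [r, s, x, y] [0, 1, 0, 0]" using cols[of 0 1 0 0] S(2) by auto
  have "config_of F9 A"
  proof (cases "(1, 1) \<in> S")
    case True
    then obtain c where c: "column_with A c [r, s, x, y] [0, 0, 1, 1]" using cols[of 0 0 1 1] by auto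
    show ?thesis
      using rows a b c by (intro config_of_F9I[of "[r, s, x, y]" A a b c]) auto
  next
    case False
    then have "(1, 0) \<in> S" "(0, 1) \<in> S" using miss[of "(1,1)"] by auto
    then obtain c d where c: "column_with A c [r, s, x, y] [0, 0, 1, 0]"
      and d: "column_with A d [r, s, x, y] [0, 0, 0, 1]"
      using cols[of 0 0 1 0] cols[of 0 0 0 1] by auto
    obtain e where e: "column_with A e [r, s, x, y] [1, 1, 0, 0]" using cols[of 1 1 0 0] S(2) by auto
    \<comment> \<open>The roles are exchanged: \<open>x, y\<close> carry the two unit columns and
      \<open>r, s\<close> the double one, in column \<open>e\<close>.\<close>
    show ?thesis
      using rows c d e
      by (intro config_of_F9I[of "[x, y, r, s]" A c d e]) (auto simp: column_with_def)
  qed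
  moreover have "(1, 0) \<in> S \<or> (0, 1) \<in> S" using miss[of "(1,0)" "(0,1)"] by auto
  then have "config_of F10 A"
  proof
    assume "(1, 0) \<in> S"
    then obtain c where c: "column_with A c [r, s, x, y] [0, 0, 1, 0]" using cols[of 0 0 1 0] by auto
    show ?thesis
      using rows a b c by (intro config_of_F10I[of "[r, s, x, y]" A a b c]) auto
  next
    assume "(0, 1) \<in> S"
    then obtain c where c: "column_with A c [r, s, x, y] [0, 0, 0, 1]" using cols[of 0 0 0 1] by auto
    show ?thesis
      using rows a b c
      by (intro config_of_F10I[of "[r, s, y, x]" A a b c]) (auto simp: column_with_def)
  qed
  ultimately show ?thesis ..
qed

text \<open>Columns are identified with their supports. Three of the four pairs include
  \<open>00\<close> or \<open>11\<close>, and complementing \<open>A\<close> turns the second case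
  into the first. Each case yields both matrices of its kind, so every choice of \<open>F\<close>
  and \<open>G\<close> is covered.\<close>

lemma config_of_if_many_columns:
  assumes simple: "simple_mat A" and m: "dim_row A = m"
    and large: "dim_col A > 1 + m * (1 + m * 2)"
  shows "(config_of F9 A \<and> config_of F10 A) \<or>
         (config_of (complement_mat F9) A \<and> config_of (complement_mat F10) A)"
proof -
  define support where "support j = {i. i < m \<and> A $$ (i, j) = 1}" for j
  have zero_one: "A $$ (i, j) = of_bool (i \<in> support j)" if "i < m" "j < dim_col A" for i j
    using simple that m by (auto simp: simple_mat_iff support_def)
  have "inj_on support {..<dim_col A}"
  proof (rule inj_onI)
    fix j k assume *: "j \<in> {..<dim_col A}" "k \<in> {..<dim_col A}" "support j = support k"
    then have "\<forall>i<dim_row A. A $$ (i, j) = A $$ (i, k)"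
      using zero_one m by auto
    then show "j = k" using simple * by (auto simp: simple_mat_iff)
  qed
  then have card: "card (support ` {..<dim_col A}) = dim_col A" by (simp add: card_image)
  have sub: "support ` {..<dim_col A} \<subseteq> Pow {..<m}" by (auto simp: support_def)
  have large': "card (support ` {..<dim_col A}) > 1 + card {..<m} * (1 + card {..<m} * 2)"
    using card large by simp
  obtain r s x y and S :: "(bool \<times> bool) set" where
    rows: "distinct [r, s, x, y]" "{r, s, x, y} \<subseteq> {..<m}" and S: "card S = 3"
    and tr: "\<And>a b u v. (u, v) \<in> S \<Longrightarrow> \<exists>B\<in>support ` {..<dim_col A}.
               (r \<in> B \<longleftrightarrow> a) \<and> (s \<in> B \<longleftrightarrow> b) \<and> (x \<in> B \<longleftrightarrow> u) \<and> (y \<in> B \<longleftrightarrow> v)"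
    by (fact ex_product_trace[OF finite_lessThan sub large'])
  have card_image': "card (map_prod h h ` S) = 3" if "inj h" for h :: "bool \<Rightarrow> int"
    using S that by (subst card_image) (auto intro: inj_on_subset prod.inj_map)
  have inj1: "inj (of_bool :: bool \<Rightarrow> int)" and inj2: "inj (\<lambda>b. of_bool (\<not> b) :: int)"
    by (auto simp: inj_on_def)
  show ?thesis
  proof (cases "(False, False) \<in> S")
    case True
    have "config_of F9 A \<and> config_of F10 A"
    proof (rule config_of_F9_F10_of_product_trace[of r s x y _ "map_prod of_bool of_bool ` S"])
      fix a b u v :: int
      assume ab: "a \<in> {0, 1}" "b \<in> {0, 1}" and "(u, v) \<in> map_prod of_bool of_bool ` S"
      then obtain u' v' where uv: "(u', v') \<in> S" "u = of_bool u'" "v = of_bool v'" by auto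
      from tr[OF uv(1), of "a = 1" "b = 1"]
      show "\<exists>j. column_with A j [r, s, x, y] [a, b, u, v]"
        using ab uv rows(2) zero_one by (auto simp: column_with_def)
    next
      show "(0, 0) \<in> map_prod of_bool of_bool ` S"
        using imageI[OF True, of "map_prod of_bool of_bool"] by simp
    qed (use rows m card_image'[OF inj1] in auto)
    then show ?thesis ..
  next
    case False
    have "(True, True) \<in> S"
    proof (rule ccontr)
      assume "\<not> ?thesis"
      with False have "S \<subseteq> {(True, False), (False, True)}"
        by (auto simp: subset_iff) (metis (full_types))+
      then have "card S \<le> card {(True, False), (False, True)}" by (intro card_mono) auto
      with S show False by simp
    qed
    let ?h = "\<lambda>b. of_bool (\<not> b) :: int"
    have "config_of F9 (complement_mat A) \<and> config_of F10 (complement_mat A)"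
    proof (rule config_of_F9_F10_of_product_trace[of r s x y _ "map_prod ?h ?h ` S"])
      fix a b u v :: int
      assume ab: "a \<in> {0, 1}" "b \<in> {0, 1}" and "(u, v) \<in> map_prod ?h ?h ` S"
      then obtain u' v' where uv: "(u', v') \<in> S" "u = ?h u'" "v = ?h v'" by auto
      \<comment> \<open>An entry of the complement is 0 exactly when the row belongs to the
        support.\<close>
      from tr[OF uv(1), of "a = 0" "b = 0"]
      show "\<exists>j. column_with (complement_mat A) j [r, s, x, y] [a, b, u, v]"
        using ab uv rows(2) zero_one m by (auto simp: column_with_def)
    next
      show "(0, 0) \<in> map_prod ?h ?h ` S"
        using imageI[OF \<open>(True, True) \<in> S\<close>, of "map_prod ?h ?h"] by simp
    qed (use rows m card_image'[OF inj2] in auto)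
    then show ?thesis by (simp add: config_of_complement)
  qed
qed

section \<open>Lower bound\<close>

text \<open>The base-\<open>h\<close> digits of \<open>j\<close> are the heights of the two towers
  in column \<open>j\<close>. Heights run from 0 to \<open>h - 1\<close>, and for odd
  \<open>m\<close> the last row is zero.\<close>

definition tower_product :: "nat \<Rightarrow> int mat" where
  "tower_product m = (let h = m div 2 in mat m (h * h)
     (\<lambda>(i, j). of_bool (if i < h then i < j div h else i < h + j mod h)))"

lemma simple_mat_tower_product: "simple_mat (tower_product m)"
proof -
  define h where "h = m div 2"
  have T: "tower_product m = mat m (h * h)
     (\<lambda>(i, j). of_bool (if i < h then i < j div h else i < h + j mod h))"
    by (simp only: tower_product_def h_def Let_def)
  have "j = k" if jk: "j < h * h" "k < h * h"
    and eq: "\<forall>i<m. tower_product m $$ (i, j) = tower_product m $$ (i, k)" for j k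
  proof -
    have "h > 0" using jk by (cases h) auto
    have div: "j div h < h" "k div h < h" and md: "j mod h < h" "k mod h < h"
      using jk \<open>h > 0\<close> by (auto simp: less_mult_imp_div_less)
    have m: "2 * h \<le> m" by (simp add: h_def)
    have eq': "(if i < h then i < j div h else i < h + j mod h) =
               (if i < h then i < k div h else i < h + k mod h)" if "i < m" for i
      using eq[rule_format, OF that] that jk by (simp add: T of_bool_eq_iff split: if_splits)
    \<comment> \<open>Row \<open>j div h\<close> is the topmost zero of column \<open>j\<close> in
      the upper tower; comparing there and in row \<open>k div h\<close> rules out both strict
      inequalities.\<close>
    have "j div h = k div h"
      using eq'[of "j div h"] eq'[of "k div h"] div m by (auto split: if_splits)
    moreover have "j mod h = k mod h"
      using eq'[of "h + j mod h"] eq'[of "h + k mod h"] md m by (auto split: if_splits)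
    ultimately show "j = k" by (metis div_mult_mod_eq)
  qed
  then show ?thesis
    unfolding simple_mat_iff by (auto simp: T)
qed

text \<open>The value \<open>v\<close> allows the identity matrix (\<open>v = 1\<close>) and its complement (\<open>v = 0\<close>) to be
  excluded at once.\<close>

lemma tower_product_no_identity:
  fixes f g :: "nat \<Rightarrow> nat"
  assumes f: "inj_on f {..<3}" "f ` {..<3} \<subseteq> {..<m}"
    and g: "g ` {..<3} \<subseteq> {..<dim_col (tower_product m)}"
    and id: "\<And>i j. i < 3 \<Longrightarrow> j < 3 \<Longrightarrow> tower_product m $$ (f i, g j) = v \<longleftrightarrow> i = j"
  shows False
proof -
  define h where "h = m div 2"
  \<comment> \<open>Within a tower, a one forces ones in all rows above it.\<close>
  have mono: "tower_product m $$ (i', j) = 1 \<Longrightarrow> tower_product m $$ (i, j) = 1"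
    if "i < i'" "i' < m" "i < h \<longleftrightarrow> i' < h" "j < dim_col (tower_product m)" for i i' j
    using that by (auto simp: tower_product_def h_def Let_def split: if_splits)
  have zero_one: "tower_product m $$ (i, j) \<in> {0, 1}"
    if "i < m" "j < dim_col (tower_product m)" for i j
    using that by (auto simp: tower_product_def Let_def)
  \<comment> \<open>Columns \<open>g p\<close> and \<open>g q\<close> would show
    \<open>(v, 1 - v)\<close> and \<open>(1 - v, v)\<close> on the two rows, and one of these puts a
    zero above a one.\<close>
  have less: False if "p < 3" "q < 3" "f p < f q" "f p < h \<longleftrightarrow> f q < h" for p q
  proof -
    have lt: "f p < m" "f q < m" "g p < dim_col (tower_product m)" "g q < dim_col (tower_product m)"
      using f(2) g that by auto
    have "p \<noteq> q" using that by auto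
    then show False
      using id[of p p] id[of p q] id[of q p] id[of q q] that lt
        mono[of "f p" "f q" "g p"] mono[of "f p" "f q" "g q"]
        zero_one[of "f p" "g p"] zero_one[of "f p" "g q"] zero_one[of "f q" "g p"] zero_one[of "f q" "g q"]
      by auto
  qed
  have False if "p < 3" "q < 3" "p \<noteq> q" "f p < h \<longleftrightarrow> f q < h" for p q
  proof -
    have "f p \<noteq> f q" using inj_onD[OF f(1), of p q] that by auto
    then show False using less[of p q] less[of q p] that by linarith
  qed
  \<comment> \<open>Pigeonhole: three rows in two towers.\<close>
  from this[of 0 1] this[of 0 2] this[of 1 2] show False by auto
qed

text \<open>The first three rows of each of the four matrices form the identity matrix or its
  complement; the fourth row is dropped.\<close>

lemma tower_product_avoids:
  assumes "F \<in> {F9, F10, complement_mat F9, complement_mat F10}"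
  shows "\<not> config_of F (tower_product m)"
proof
  assume "config_of F (tower_product m)"
  then obtain f g where "inj_on f {..<dim_row F}"
    "f ` {..<dim_row F} \<subseteq> {..<dim_row (tower_product m)}"
    "g ` {..<dim_col F} \<subseteq> {..<dim_col (tower_product m)}"
    and ent: "\<forall>i<dim_row F. \<forall>j<dim_col F. tower_product m $$ (f i, g j) = F $$ (i, j)"
    unfolding config_of_iff by blast
  moreover have dims: "dim_row F = 4" "dim_col F = 3"
    using assms by auto
  moreover have "dim_row (tower_product m) = m" by (simp add: tower_product_def Let_def)
  ultimately have fg: "inj_on f {..<4}" "f ` {..<4} \<subseteq> {..<m}"
    "g ` {..<3} \<subseteq> {..<dim_col (tower_product m)}" by simp_all
  have f3: "inj_on f {..<3}" "f ` {..<3} \<subseteq> {..<m}"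
    using fg(1,2) inj_on_subset[of f "{..<4}" "{..<3}"] image_mono[of "{..<3}" "{..<4}" f] by auto
  have id: "F9 $$ (i, j) = of_bool (i = j)" "F10 $$ (i, j) = of_bool (i = j)"
    if "i < 3" "j < 3" for i j
    using that unfolding less_3_cases by (auto simp: F9_def F10_def mat_of_rows_list_def)
  have "\<exists>v. \<forall>i<3. \<forall>j<3. F $$ (i, j) = v \<longleftrightarrow> i = j"
  proof (cases "F \<in> {F9, F10}")
    case True
    then show ?thesis by (intro exI[of _ 1]) (auto simp: id)
  next
    case False
    with assms show ?thesis by (intro exI[of _ 0]) (auto simp: id)
  qed
  then obtain v where "\<forall>i<3. \<forall>j<3. F $$ (i, j) = v \<longleftrightarrow> i = j" ..
  then show False
    using tower_product_no_identity[OF f3 fg(3), of v] ent dims by auto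
qed

section \<open>Order of growth\<close>

theorem proposition3p4:
  fixes F G :: "int mat"
  assumes "F \<in> {F9, F10}"
    and "G \<in> {complement_mat F9, complement_mat F10}"
  shows "(\<lambda>m. real (forb m {F, G})) \<in> \<Theta>(\<lambda>m. real m ^ 2)"
proof -
  have le: "dim_col A \<le> 1 + m * (1 + m * 2)" if "A \<in> avoiding_mats m {F, G}" for A m
    using that assms config_of_if_many_columns[of A m] by (force simp: avoiding_mats_def)
  \<comment> \<open>Finiteness, together with a member of the family, makes \<open>Max\<close> in
    \<open>forb\<close> a genuine maximum.\<close>
  have fin: "finite (dim_col ` avoiding_mats m {F, G})" for m
    using le by (intro finite_subset[OF _ finite_atMost[of "1 + m * (1 + m * 2)"]]) auto
  have mem: "tower_product m \<in> avoiding_mats m {F, G}" for m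
    using assms tower_product_avoids simple_mat_tower_product
    by (auto simp: avoiding_mats_def tower_product_def Let_def)
  have upper: "forb m {F, G} \<le> 1 + m * (1 + m * 2)" for m
    unfolding forb_def using fin mem[of m] le by (intro Max.boundedI) auto
  have "dim_col (tower_product m) \<le> forb m {F, G}" for m
    unfolding forb_def using fin mem by (intro Max_ge) auto
  then have lower: "(m div 2) * (m div 2) \<le> forb m {F, G}" for m
    by (simp add: tower_product_def Let_def)
  show ?thesis
  proof (rule bigthetaI)
    have "real (forb m {F, G}) \<le> 4 * real m ^ 2" if "m \<ge> 1" for m
    proof -
      \<comment> \<open>For \<open>m \<ge> 1\<close> both 1 and \<open>m\<close> are at most
        \<open>m ^ 2\<close>, which gives 1 + 1 + 2 = 4.\<close>
      have "1 + m * (1 + m * 2) \<le> 4 * m ^ 2"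
        using mult_le_mono[OF that that] mult_le_mono1[OF that, of m]
        unfolding power2_eq_square distrib_left mult_1_right mult.assoc[symmetric] by linarith
      with upper[of m] have "forb m {F, G} \<le> 4 * m ^ 2" by linarith
      then show ?thesis by (metis of_nat_le_iff of_nat_mult of_nat_numeral of_nat_power)
    qed
    then show "(\<lambda>m. real (forb m {F, G})) \<in> O(\<lambda>m. real m ^ 2)"
      by (intro bigoI[of _ 4] eventually_sequentiallyI[of 1]) simp
    have "real m ^ 2 \<le> 9 * real (forb m {F, G})" if "m \<ge> 2" for m
    proof -
      \<comment> \<open>The factor 3 is attained at \<open>m = 3\<close>; its square is the constant
        9.\<close>
      have "m \<le> 3 * (m div 2)" using that by linarith
      from mult_le_mono[OF this this] lower[of m] have "m ^ 2 \<le> 9 * forb m {F, G}"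
        by (simp add: power2_eq_square)
      then show ?thesis by (metis of_nat_le_iff of_nat_mult of_nat_numeral of_nat_power)
    qed
    then have "(\<lambda>m. real m ^ 2) \<in> O(\<lambda>m. real (forb m {F, G}))"
      by (intro bigoI[of _ 9] eventually_sequentiallyI[of 2]) simp
    then show "(\<lambda>m. real (forb m {F, G})) \<in> \<Omega>(\<lambda>m. real m ^ 2)"
      by (simp add: bigomega_iff_bigo)
  qed
qed

end
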